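(* Let $k$ be a field, let $A$ and $B$ be DG-algebras with $H_0(A)\cong k$ and $H_0(B)\cong k$, and let $\phi : A\to B$ be a morphism of DG-algebras that is a quasi-isomorphism. Let $\mathcal{B}^A$ be a $k$-basis of $H_{\geq 1}(A)$ and let $\mu$ be a trivial Massey operation on $A$ with respect to $\mathcal{B}^A$. Then the function $\mu'$ defined by $$\mu'\big(\phi_*(h_{\lambda_1}),\dots,\phi_*(h_{\lambda_p})\big):=\phi\big(\mu(h_{\lambda_1},\dots,h_{\lambda_p})\big),\qquad p\geq 1,\ h_{\lambda_1},\dots,h_{\lambda_p}\in\mathcal{B}^A,$$ is a trivial Massey operation on $B$ with respect to the basis $\phi_*(\mathcal{B}^A)=\{\phi_*(h)\mid h\in\mathcal{B}^A\}$, where $\phi_*:H_\bullet(A)\to H_\bullet(B)$ is the map induced on homology.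
   Context: A DG-algebra $(A,d)$ over a commutative Noetherian ring $R$ is a complex of finitely generated free $R$-modules (concentrated in non-negative homological degrees) with a unitary, associative multiplication $A\otimes_R A\to A$ satisfying $A_iA_j\subseteq A_{i+j}$; $d(f_if_j)=d(f_i)f_j+(-1)^i f_i d(f_j)$; $f_if_j=(-1)^{ij}f_jf_i$; and $f_i^2=0$ if $i$ is odd, where $f_\ell\in A_\ell$. Morphisms of DG-algebras are degree-preserving unital ring homomorphisms commuting with the differentials; the base rings of $A$ and $B$ may differ, and homology is regarded as a $k$-vector space compatibly, so that the induced maps on homology are $k$-linear. For a homogeneous element $a$ of homological degree $|a|$, put $\overline{a}:=(-1)^{|a|+1}a$. Let $A$ be a DG-algebra with $H_0(A)\cong k$ and let $\mathcal{B}=\{h_\lambda\}_{\lambda\in\Lambda}$ be a $k$-basis of $H_{\geq 1}(A)$ consisting of homogeneous elements. A trivial Massey operation on $A$ with respect to $\mathcal{B}$ is a function $\mu:\coprod_{i=1}^\infty \mathcal{B}^i\to A$ with homogeneous values ($\mu(h_{\lambda_1},\dots,h_{\lambda_p})$ has degree $|h_{\lambda_1}|+\cdots+|h_{\lambda_p}|+p-1$) such that $\mu(h_\lambda)=z_\lambda$ is a cycle whose homology class is $h_\lambda$, and $$d\mu(h_{\lambda_1},\dots,h_{\lambda_p})=\sum_{j=1}^{p-1}\overline{\mu(h_{\lambda_1},\dots,h_{\lambda_j})}\,\mu(h_{\lambda_{j+1}},\dots,h_{\lambda_p}).$$ *)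

theory Defs
  imports "HOL-Algebra.Module" "HOL-Algebra.QuotRing" "HOL-Algebra.Ring_Divisibility"
begin

section \<open>Bases of modules\<close>

definition lin_indep_set ::
    "('r, 'p) ring_scheme \<Rightarrow> ('r, 'a, 'q) module_scheme \<Rightarrow> 'a set \<Rightarrow> bool"
  where "lin_indep_set R M X \<longleftrightarrow>
    (\<forall>S c. S \<subseteq> X \<and> finite S \<and> c \<in> S \<rightarrow> carrier R \<and>
       (\<Oplus>\<^bsub>M\<^esub>b\<in>S. c b \<odot>\<^bsub>M\<^esub> b) = \<zero>\<^bsub>M\<^esub> \<longrightarrow> (\<forall>b\<in>S. c b = \<zero>\<^bsub>R\<^esub>))"

definition spanning_set ::
    "('r, 'p) ring_scheme \<Rightarrow> ('r, 'a, 'q) module_scheme \<Rightarrow> 'a set \<Rightarrow> bool"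
  where "spanning_set R M X \<longleftrightarrow>
    (\<forall>x\<in>carrier M. \<exists>S c. S \<subseteq> X \<and> finite S \<and> c \<in> S \<rightarrow> carrier R \<and>
       x = (\<Oplus>\<^bsub>M\<^esub>b\<in>S. c b \<odot>\<^bsub>M\<^esub> b))"

definition module_basis ::
    "('r, 'p) ring_scheme \<Rightarrow> ('r, 'a, 'q) module_scheme \<Rightarrow> 'a set \<Rightarrow> bool"
  where "module_basis R M X \<longleftrightarrow>
    X \<subseteq> carrier M \<and> lin_indep_set R M X \<and> spanning_set R M X"

section \<open>DG-algebras\<close>

text \<open>A DG-algebra is encoded by its total module, the (internal) direct sum of the homogeneous
  components \<open>grade A i\<close>, with a differential defined on the total module.\<close>

record ('r, 'a) dg_algebra = "('r, 'a) module" +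
  grade :: "nat \<Rightarrow> 'a set"
  diff :: "'a \<Rightarrow> 'a"

definition signed :: "('a, 'm) ring_scheme \<Rightarrow> nat \<Rightarrow> 'a \<Rightarrow> 'a"  \<comment> \<open>\<open>(-1)^n x\<close>\<close>
  where "signed A n x = (if even n then x else \<ominus>\<^bsub>A\<^esub> x)"

text \<open>\<open>smult_mult_left\<close> and \<open>smult_mult_right\<close> say that the multiplication is \<open>R\<close>-bilinear, that is,
  a map on the tensor product of \<open>A\<close> with itself over \<open>R\<close>. The locale \<^locale>\<open>algebra\<close> is not
  applicable here, as it requires strict commutativity.\<close>

locale dg_algebra = module R A + R: noetherian_ring R + A: ring A
  for R :: "('r, 'p) ring_scheme" and A :: "('r, 'a, 'm) dg_algebra_scheme" +
  assumes smult_mult_left: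
      "\<lbrakk>r \<in> carrier R; x \<in> carrier A; y \<in> carrier A\<rbrakk> \<Longrightarrow>
        (r \<odot>\<^bsub>A\<^esub> x) \<otimes>\<^bsub>A\<^esub> y = r \<odot>\<^bsub>A\<^esub> (x \<otimes>\<^bsub>A\<^esub> y)"
    and smult_mult_right:
      "\<lbrakk>r \<in> carrier R; x \<in> carrier A; y \<in> carrier A\<rbrakk> \<Longrightarrow>
        x \<otimes>\<^bsub>A\<^esub> (r \<odot>\<^bsub>A\<^esub> y) = r \<odot>\<^bsub>A\<^esub> (x \<otimes>\<^bsub>A\<^esub> y)"
    and grade_submodule: "submodule (grade A i) R A"
    and grade_direct_sum:
      "x \<in> carrier A \<Longrightarrow>
        \<exists>!f. (\<forall>i. f i \<in> grade A i) \<and> finite {i. f i \<noteq> \<zero>\<^bsub>A\<^esub>} \<and>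
             x = (\<Oplus>\<^bsub>A\<^esub>i\<in>{i. f i \<noteq> \<zero>\<^bsub>A\<^esub>}. f i)"
    and grade_fg_free: "\<exists>X. finite X \<and> module_basis R (A\<lparr>carrier := grade A i\<rparr>) X"
    and one_grade: "\<one>\<^bsub>A\<^esub> \<in> grade A 0"
    and mult_grade: "\<lbrakk>x \<in> grade A i; y \<in> grade A j\<rbrakk> \<Longrightarrow> x \<otimes>\<^bsub>A\<^esub> y \<in> grade A (i + j)"
    and diff_closed: "x \<in> carrier A \<Longrightarrow> diff A x \<in> carrier A"
    and diff_add: "\<lbrakk>x \<in> carrier A; y \<in> carrier A\<rbrakk> \<Longrightarrow> diff A (x \<oplus>\<^bsub>A\<^esub> y) = diff A x \<oplus>\<^bsub>A\<^esub> diff A y"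
    and diff_smult: "\<lbrakk>r \<in> carrier R; x \<in> carrier A\<rbrakk> \<Longrightarrow> diff A (r \<odot>\<^bsub>A\<^esub> x) = r \<odot>\<^bsub>A\<^esub> diff A x"
    and diff_grade_Suc: "x \<in> grade A (Suc i) \<Longrightarrow> diff A x \<in> grade A i"
    and diff_grade_0: "x \<in> grade A 0 \<Longrightarrow> diff A x = \<zero>\<^bsub>A\<^esub>"
    and diff_diff: "x \<in> carrier A \<Longrightarrow> diff A (diff A x) = \<zero>\<^bsub>A\<^esub>"
    and leibniz:
      "\<lbrakk>x \<in> grade A i; y \<in> grade A j\<rbrakk> \<Longrightarrow>
        diff A (x \<otimes>\<^bsub>A\<^esub> y) = diff A x \<otimes>\<^bsub>A\<^esub> y \<oplus>\<^bsub>A\<^esub> signed A i (x \<otimes>\<^bsub>A\<^esub> diff A y)"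
    and graded_comm:
      "\<lbrakk>x \<in> grade A i; y \<in> grade A j\<rbrakk> \<Longrightarrow> x \<otimes>\<^bsub>A\<^esub> y = signed A (i * j) (y \<otimes>\<^bsub>A\<^esub> x)"
    and odd_square: "\<lbrakk>x \<in> grade A i; odd i\<rbrakk> \<Longrightarrow> x \<otimes>\<^bsub>A\<^esub> x = \<zero>\<^bsub>A\<^esub>"

text \<open>Morphisms are not required to be linear over the base rings, which may differ.\<close>

definition dg_morphism ::
    "('r, 'a, 'm) dg_algebra_scheme \<Rightarrow> ('s, 'b, 'n) dg_algebra_scheme \<Rightarrow> ('a \<Rightarrow> 'b) \<Rightarrow> bool"
  where "dg_morphism A B \<phi> \<longleftrightarrow>
    \<phi> \<in> ring_hom A B \<and>
    (\<forall>i. \<forall>x\<in>grade A i. \<phi> x \<in> grade B i) \<and>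
    (\<forall>x\<in>carrier A. \<phi> (diff A x) = diff B (\<phi> x))"

text \<open>The degree of a nonzero homogeneous element with respect to a grading \<open>G\<close>. The zero element,
  which lies in every \<open>G n\<close>, gets degree \<open>0\<close>.\<close>

definition hdeg :: "(nat \<Rightarrow> 'a set) \<Rightarrow> 'a \<Rightarrow> nat"
  where "hdeg G x = (LEAST n. x \<in> G n)"

definition bar :: "('r, 'a, 'm) dg_algebra_scheme \<Rightarrow> 'a \<Rightarrow> 'a"
  where "bar A x = signed A (hdeg (grade A) x + 1) x"

section \<open>Homology\<close>

definition cycles :: "('r, 'a, 'm) dg_algebra_scheme \<Rightarrow> 'a set"
  where "cycles A = {z \<in> carrier A. diff A z = \<zero>\<^bsub>A\<^esub>}"

definition boundaries :: "('r, 'a, 'm) dg_algebra_scheme \<Rightarrow> 'a set"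
  where "boundaries A = diff A ` carrier A"

text \<open>The total homology, as the quotient of the subring of cycles by the ideal of boundaries.\<close>

definition homology :: "('r, 'a, 'm) dg_algebra_scheme \<Rightarrow> 'a set ring"
  where "homology A = (A\<lparr>carrier := cycles A\<rparr>) Quot (boundaries A)"

definition hclass :: "('r, 'a, 'm) dg_algebra_scheme \<Rightarrow> 'a \<Rightarrow> 'a set"
  where "hclass A z = boundaries A +>\<^bsub>A\<^esub> z"

definition homology_grade :: "('r, 'a, 'm) dg_algebra_scheme \<Rightarrow> nat \<Rightarrow> 'a set set"
  where "homology_grade A n = hclass A ` (cycles A \<inter> grade A n)"

definition homology0 :: "('r, 'a, 'm) dg_algebra_scheme \<Rightarrow> 'a set ring"
  where "homology0 A = (homology A)\<lparr>carrier := homology_grade A 0\<rparr>"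

definition homology_pos :: "('r, 'a, 'm) dg_algebra_scheme \<Rightarrow> 'a set set"
  where "homology_pos A =
    {(\<Oplus>\<^bsub>homology A\<^esub>i\<in>I. h i) | I h. finite I \<and> I \<subseteq> {1..} \<and> (\<forall>i\<in>I. h i \<in> homology_grade A i)}"

definition homology_map ::
    "('r, 'a, 'm) dg_algebra_scheme \<Rightarrow> ('s, 'b, 'n) dg_algebra_scheme \<Rightarrow>
      ('a \<Rightarrow> 'b) \<Rightarrow> 'a set \<Rightarrow> 'b set"
  where "homology_map A B \<phi> X = the_elem ((\<lambda>z. hclass B (\<phi> z)) ` X)"

definition quasi_iso ::
    "('r, 'a, 'm) dg_algebra_scheme \<Rightarrow> ('s, 'b, 'n) dg_algebra_scheme \<Rightarrow> ('a \<Rightarrow> 'b) \<Rightarrow> bool"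
  where "quasi_iso A B \<phi> \<longleftrightarrow>
    (\<forall>n. bij_betw (homology_map A B \<phi>) (homology_grade A n) (homology_grade B n))"

text \<open>Given an isomorphism \<open>\<epsilon>\<close> from \<open>k\<close> to the degree-zero homology, the homology becomes a vector
  space over \<open>k\<close>, with \<open>c \<in> k\<close> acting as multiplication by \<open>\<epsilon> c\<close>.\<close>

definition homology_space ::
    "('k \<Rightarrow> 'a set) \<Rightarrow> ('r, 'a, 'm) dg_algebra_scheme \<Rightarrow> ('k, 'a set) module"
  where "homology_space \<epsilon> A =
    \<lparr>carrier = carrier (homology A), mult = mult (homology A), one = one (homology A),
     zero = zero (homology A), add = add (homology A),
     smult = (\<lambda>c h. \<epsilon> c \<otimes>\<^bsub>homology A\<^esub> h)\<rparr>"

definition homogeneous_basis ::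
    "('k, 'p) ring_scheme \<Rightarrow> ('k \<Rightarrow> 'a set) \<Rightarrow> ('r, 'a, 'm) dg_algebra_scheme \<Rightarrow> 'a set set \<Rightarrow> bool"
  where "homogeneous_basis k \<epsilon> A \<B> \<longleftrightarrow>
    \<B> \<subseteq> (\<Union>n\<in>{1..}. homology_grade A n) \<and>
    module_basis k ((homology_space \<epsilon> A)\<lparr>carrier := homology_pos A\<rparr>) \<B>"

section \<open>Trivial Massey operations\<close>

text \<open>The disjoint union of the powers \<open>\<B>^p\<close> with \<open>p \<ge> 1\<close>.\<close>

definition words :: "'h set \<Rightarrow> 'h list set"
  where "words \<B> = {hs. hs \<noteq> [] \<and> set hs \<subseteq> \<B>}"

definition trivial_massey_operation ::
    "('k, 'p) ring_scheme \<Rightarrow> ('k \<Rightarrow> 'a set) \<Rightarrow> ('r, 'a, 'm) dg_algebra_scheme \<Rightarrow> 'a set set \<Rightarrow>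
      ('a set list \<Rightarrow> 'a) \<Rightarrow> bool"
  where "trivial_massey_operation k \<epsilon> A \<B> \<mu> \<longleftrightarrow>
    homogeneous_basis k \<epsilon> A \<B> \<and>
    (\<forall>hs\<in>words \<B>.
       \<mu> hs \<in> grade A (sum_list (map (hdeg (homology_grade A)) hs) + length hs - 1)) \<and>
    (\<forall>h\<in>\<B>. \<mu> [h] \<in> cycles A \<and> hclass A (\<mu> [h]) = h) \<and>
    (\<forall>hs\<in>words \<B>.
       diff A (\<mu> hs) =
         (\<Oplus>\<^bsub>A\<^esub>j\<in>{1..<length hs}. bar A (\<mu> (take j hs)) \<otimes>\<^bsub>A\<^esub> \<mu> (drop j hs)))"

end

theory Submission
  imports Defs "HOL-Algebra.Subrings"
begin

text \<open>A morphism of DG-algebras carries products, sums, signs and differentials of \<open>A\<close> to those of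
  \<open>B\<close>, so applying \<open>\<phi>\<close> to the Massey equations of \<open>\<mu>\<close> yields the equations for \<open>\<mu>'\<close>. The sign in
  the bar involution is read off from the degree of an element, and \<open>\<phi>\<close> changes the degree of a
  homogeneous element only by sending it to zero, where signs are invisible (\<open>phi_bar\<close>).

  It remains to see that \<open>\<phi>\<^sub>*\<close> carries the basis \<open>\<B>\<close> to a homogeneous basis, preserves the degrees of
  its elements and is injective on words, so that \<open>\<mu>'\<close> is well defined. All three follow once the
  bijections between the homology groups in each degree are assembled into one injection on total
  homology. If \<open>z\<close> is a cycle and \<open>\<phi> z = d w\<close>, then comparing components in degree \<open>i\<close> gives
  \<open>\<phi> z\<^sub>i = d w\<^sub>i\<^sub>+\<^sub>1\<close>, hence every \<open>z\<^sub>i\<close> is a boundary and so is \<open>z\<close> (\<open>phi_reflects_boundaries\<close>).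
  As preimages can be chosen degree by degree, \<open>\<phi>\<^sub>*\<close> restricts to a \<open>k\<close>-linear bijection between the
  parts of positive degree (\<open>homology_map_pos_bij\<close>), and linear bijections preserve bases (\<open>module_basis_image\<close>).

  The Leibniz rule and the quasi-isomorphism are given degree by degree, whereas homology is the
  quotient of the ring of all cycles by the ideal of all boundaries. Homogeneous components mediate
  between the two: they are additive, and \<open>(d x)\<^sub>i = d x\<^sub>i\<^sub>+\<^sub>1\<close> (\<open>component_diff\<close>).\<close>

section \<open>Additive maps and bases\<close>

lemma (in abelian_group_hom) hom_finsum:
  "f \<in> I \<rightarrow> carrier G \<Longrightarrow> h (\<Oplus>\<^bsub>G\<^esub>i\<in>I. f i) = (\<Oplus>\<^bsub>H\<^esub>i\<in>I. h (f i))"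
  by (induct I rule: infinite_finite_induct) (auto simp: Pi_def)

lemma abelian_group_homI':
  assumes "abelian_group G" "abelian_group H"
    and "\<And>x. x \<in> carrier G \<Longrightarrow> f x \<in> carrier H"
    and "\<And>x y. \<lbrakk>x \<in> carrier G; y \<in> carrier G\<rbrakk> \<Longrightarrow> f (x \<oplus>\<^bsub>G\<^esub> y) = f x \<oplus>\<^bsub>H\<^esub> f y"
  shows "abelian_group_hom G H f"
  using assms
  by (intro abelian_group_homI group_hom.intro group_hom_axioms.intro)
     (auto simp: hom_def abelian_group.a_group)

lemma module_basis_image:
  assumes hom: "abelian_group_hom M N f"
    and bij: "bij_betw f (carrier M) (carrier N)"
    and smult_closed: "\<And>c x. \<lbrakk>c \<in> carrier R; x \<in> carrier M\<rbrakk> \<Longrightarrow> c \<odot>\<^bsub>M\<^esub> x \<in> carrier M"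
    and smult: "\<And>c x. \<lbrakk>c \<in> carrier R; x \<in> carrier M\<rbrakk> \<Longrightarrow> f (c \<odot>\<^bsub>M\<^esub> x) = c \<odot>\<^bsub>N\<^esub> f x"
    and basis: "module_basis R M X"
  shows "module_basis R N (f ` X)"
proof -
  interpret f: abelian_group_hom M N f by fact
  have X: "X \<subseteq> carrier M" and indep: "lin_indep_set R M X" and span: "spanning_set R M X"
    using basis by (auto simp: module_basis_def)
  have inj: "inj_on f (carrier M)" and surj: "f ` carrier M = carrier N"
    using bij by (auto simp: bij_betw_def)
  have combination: "(\<Oplus>\<^bsub>N\<^esub>b\<in>f ` T. c b \<odot>\<^bsub>N\<^esub> b) = f (\<Oplus>\<^bsub>M\<^esub>b\<in>T. c (f b) \<odot>\<^bsub>M\<^esub> b)"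
    if T: "T \<subseteq> X" and c: "\<And>b. b \<in> T \<Longrightarrow> c (f b) \<in> carrier R" for T c
  proof -
    have TM: "T \<subseteq> carrier M" using T X by blast
    have closed: "c (f b) \<odot>\<^bsub>M\<^esub> b \<in> carrier M" if "b \<in> T" for b
      using that TM c smult_closed by blast
    have im: "f (c (f b) \<odot>\<^bsub>M\<^esub> b) = c (f b) \<odot>\<^bsub>N\<^esub> f b" if "b \<in> T" for b
      using that TM c smult by blast
    have im_closed: "c (f b) \<odot>\<^bsub>N\<^esub> f b \<in> carrier N" if "b \<in> T" for b
      using closed[OF that] im[OF that] f.hom_closed by metis
    have "(\<Oplus>\<^bsub>N\<^esub>b\<in>f ` T. c b \<odot>\<^bsub>N\<^esub> b) = (\<Oplus>\<^bsub>N\<^esub>b\<in>T. c (f b) \<odot>\<^bsub>N\<^esub> f b)"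
      using im_closed inj_on_subset[OF inj TM]
      by (intro f.H.finsum_reindex) auto
    also have "\<dots> = (\<Oplus>\<^bsub>N\<^esub>b\<in>T. f (c (f b) \<odot>\<^bsub>M\<^esub> b))"
      using im im_closed by (intro f.H.finsum_cong') auto
    also have "\<dots> = f (\<Oplus>\<^bsub>M\<^esub>b\<in>T. c (f b) \<odot>\<^bsub>M\<^esub> b)"
      using closed by (subst f.hom_finsum) auto
    finally show ?thesis .
  qed
  have sum_closed: "(\<Oplus>\<^bsub>M\<^esub>b\<in>T. c b \<odot>\<^bsub>M\<^esub> b) \<in> carrier M"
    if "T \<subseteq> X" "\<And>b. b \<in> T \<Longrightarrow> c b \<in> carrier R" for T c
    using that X smult_closed by (intro f.G.finsum_closed) blast
  have "f ` X \<subseteq> carrier N" using X surj by blast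
  moreover have "lin_indep_set R N (f ` X)"
    unfolding lin_indep_set_def
  proof (intro allI impI, elim conjE)
    fix S c
    assume S: "S \<subseteq> f ` X" "finite S" and c: "c \<in> S \<rightarrow> carrier R"
      and zero: "(\<Oplus>\<^bsub>N\<^esub>b\<in>S. c b \<odot>\<^bsub>N\<^esub> b) = \<zero>\<^bsub>N\<^esub>"
    obtain T where T: "T \<subseteq> X" "finite T" "S = f ` T"
      using S by (meson finite_subset_image)
    have cT: "c (f b) \<in> carrier R" if "b \<in> T" for b using that T c by auto
    have "f (\<Oplus>\<^bsub>M\<^esub>b\<in>T. c (f b) \<odot>\<^bsub>M\<^esub> b) = f \<zero>\<^bsub>M\<^esub>"
      using combination[of T c] T(1) cT zero T(3) f.hom_zero by simp
    hence "(\<Oplus>\<^bsub>M\<^esub>b\<in>T. c (f b) \<odot>\<^bsub>M\<^esub> b) = \<zero>\<^bsub>M\<^esub>"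
      using inj sum_closed[of T "\<lambda>b. c (f b)"] T(1) cT by (meson f.G.zero_closed inj_onD)
    hence "\<forall>b\<in>T. c (f b) = \<zero>\<^bsub>R\<^esub>"
      using indep[unfolded lin_indep_set_def, rule_format, of T "\<lambda>b. c (f b)"] T cT by blast
    thus "\<forall>b\<in>S. c b = \<zero>\<^bsub>R\<^esub>" using T(3) by simp
  qed
  moreover have "spanning_set R N (f ` X)"
    unfolding spanning_set_def
  proof
    fix y assume "y \<in> carrier N"
    then obtain x where x: "x \<in> carrier M" "y = f x" using surj by blast
    obtain S c where S: "S \<subseteq> X" "finite S" "c \<in> S \<rightarrow> carrier R"
      and xS: "x = (\<Oplus>\<^bsub>M\<^esub>b\<in>S. c b \<odot>\<^bsub>M\<^esub> b)"
      using span[unfolded spanning_set_def, rule_format, OF x(1)] by (elim exE conjE) (rule that)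
    \<comment> \<open>Coefficients on the image are obtained by transporting \<open>c\<close> along the inverse of \<open>f\<close>.\<close>
    define c' where "c' = c \<circ> the_inv_into S f"
    have injS: "inj_on f S" using inj S X by (meson inj_on_subset subset_trans)
    have c': "c' (f b) = c b" if "b \<in> S" for b
      using the_inv_into_f_f[OF injS that] by (simp add: c'_def)
    have cS: "c b \<in> carrier R" if "b \<in> S" for b using that S by auto
    have "y = f (\<Oplus>\<^bsub>M\<^esub>b\<in>S. c' (f b) \<odot>\<^bsub>M\<^esub> b)"
      unfolding x xS using S X cS c' smult_closed
      by (intro arg_cong[where f = f] f.G.finsum_cong') auto
    also have "\<dots> = (\<Oplus>\<^bsub>N\<^esub>b\<in>f ` S. c' b \<odot>\<^bsub>N\<^esub> b)"
      using combination[of S c'] S(1) c' cS by simp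
    finally show "\<exists>S c. S \<subseteq> f ` X \<and> finite S \<and> c \<in> S \<rightarrow> carrier R \<and>
        y = (\<Oplus>\<^bsub>N\<^esub>b\<in>S. c b \<odot>\<^bsub>N\<^esub> b)"
      using S c' cS by (intro exI[of _ "f ` S"] exI[of _ c']) auto
  qed
  ultimately show ?thesis by (simp add: module_basis_def)
qed

section \<open>Homogeneous components\<close>

text \<open>The projection of \<open>x\<close> to degree \<open>i\<close> with respect to the direct sum decomposition.\<close>

definition component :: "('r, 'a, 'm) dg_algebra_scheme \<Rightarrow> 'a \<Rightarrow> nat \<Rightarrow> 'a"
  where "component A x = (THE f. (\<forall>i. f i \<in> grade A i) \<and> finite {i. f i \<noteq> \<zero>\<^bsub>A\<^esub>} \<and>
    x = (\<Oplus>\<^bsub>A\<^esub>i\<in>{i. f i \<noteq> \<zero>\<^bsub>A\<^esub>}. f i))"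

context dg_algebra
begin

lemma grade_subset: "x \<in> grade A i \<Longrightarrow> x \<in> carrier A"
  using submoduleE(1)[OF grade_submodule] by blast

lemma grade_zero: "\<zero>\<^bsub>A\<^esub> \<in> grade A i"
  using submodule.axioms(1)[OF grade_submodule, THEN subgroup.one_closed] by simp

lemma grade_add: "\<lbrakk>x \<in> grade A i; y \<in> grade A i\<rbrakk> \<Longrightarrow> x \<oplus>\<^bsub>A\<^esub> y \<in> grade A i"
  using submoduleE(5)[OF grade_submodule] by blast

lemma component_properties:
  assumes "x \<in> carrier A"
  shows component_grade: "component A x i \<in> grade A i"
    and finite_component: "finite {i. component A x i \<noteq> \<zero>\<^bsub>A\<^esub>}"
    and sum_component: "(\<Oplus>\<^bsub>A\<^esub>i\<in>{i. component A x i \<noteq> \<zero>\<^bsub>A\<^esub>}. component A x i) = x"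
  using theI'[OF grade_direct_sum[OF assms]] unfolding component_def[symmetric] by auto

lemma component_closed: "x \<in> carrier A \<Longrightarrow> component A x i \<in> carrier A"
  using component_grade grade_subset by blast

text \<open>The index set may exceed the support, which makes the lemma applicable to sums whose terms vanish
  for some indices, as in \<open>component_add\<close>.\<close>

lemma component_unique:
  assumes f: "\<And>i. f i \<in> grade A i" and fin: "finite I"
    and supp: "\<And>i. i \<notin> I \<Longrightarrow> f i = \<zero>\<^bsub>A\<^esub>"
    and x: "x = (\<Oplus>\<^bsub>A\<^esub>i\<in>I. f i)"
  shows "component A x = f"
proof -
  have closed: "f i \<in> carrier A" for i using f grade_subset by blast
  have supp_subset: "{i. f i \<noteq> \<zero>\<^bsub>A\<^esub>} \<subseteq> I" using supp by blast
  have "x \<in> carrier A" unfolding x using closed by (intro M.finsum_closed) auto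
  moreover have "x = (\<Oplus>\<^bsub>A\<^esub>i\<in>{i. f i \<noteq> \<zero>\<^bsub>A\<^esub>}. f i)"
    unfolding x using closed fin supp_subset
    by (intro M.add.finprod_mono_neutral_cong_right) auto
  ultimately show ?thesis
    unfolding component_def using f fin supp_subset grade_direct_sum[of x]
    by (intro the1_equality) (auto intro: finite_subset)
qed

lemma component_add:
  assumes x: "x \<in> carrier A" and y: "y \<in> carrier A"
  shows "component A (x \<oplus>\<^bsub>A\<^esub> y) i = component A x i \<oplus>\<^bsub>A\<^esub> component A y i"
proof -
  let ?I = "{i. component A x i \<noteq> \<zero>\<^bsub>A\<^esub>} \<union> {i. component A y i \<noteq> \<zero>\<^bsub>A\<^esub>}"
  have fin: "finite ?I" using x y finite_component by blast
  have eq: "(\<Oplus>\<^bsub>A\<^esub>i\<in>?I. component A z i) = z"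
    if "z \<in> carrier A" "{i. component A z i \<noteq> \<zero>\<^bsub>A\<^esub>} \<subseteq> ?I" for z
  proof -
    have "(\<Oplus>\<^bsub>A\<^esub>i\<in>?I. component A z i)
        = (\<Oplus>\<^bsub>A\<^esub>i\<in>{i. component A z i \<noteq> \<zero>\<^bsub>A\<^esub>}. component A z i)"
      using that fin component_closed[OF that(1)]
      by (intro M.add.finprod_mono_neutral_cong_right) auto
    thus ?thesis using sum_component[OF that(1)] by simp
  qed
  have "component A (x \<oplus>\<^bsub>A\<^esub> y) = (\<lambda>i. component A x i \<oplus>\<^bsub>A\<^esub> component A y i)"
  proof (rule component_unique[OF _ fin])
    show "component A x i \<oplus>\<^bsub>A\<^esub> component A y i \<in> grade A i" for i
      using x y by (intro grade_add component_grade)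
    show "component A x i \<oplus>\<^bsub>A\<^esub> component A y i = \<zero>\<^bsub>A\<^esub>" if "i \<notin> ?I" for i
      using that by simp
    show "x \<oplus>\<^bsub>A\<^esub> y = (\<Oplus>\<^bsub>A\<^esub>i\<in>?I. component A x i \<oplus>\<^bsub>A\<^esub> component A y i)"
      using component_closed[OF x] component_closed[OF y] eq[OF x] eq[OF y]
      by (subst M.finsum_addf) auto
  qed
  thus ?thesis by simp
qed

lemma component_homogeneous:
  assumes "x \<in> grade A n"
  shows "component A x i = (if i = n then x else \<zero>\<^bsub>A\<^esub>)"
proof -
  have "component A x = (\<lambda>i. if i = n then x else \<zero>\<^bsub>A\<^esub>)"
    using assms grade_subset[OF assms] grade_zero
    by (intro component_unique[of _ "{n}"]) auto
  thus ?thesis by simp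
qed

lemma component_hom: "abelian_group_hom A A (\<lambda>x. component A x i)"
  by (intro abelian_group_homI' M.abelian_group_axioms component_closed component_add)

lemma diff_hom: "abelian_group_hom A A (diff A)"
  by (intro abelian_group_homI' M.abelian_group_axioms diff_closed diff_add)

lemma hdeg_grade:
  assumes "x \<in> grade A n" "x \<noteq> \<zero>\<^bsub>A\<^esub>"
  shows "hdeg (grade A) x = n"
  unfolding hdeg_def
proof (rule Least_equality)
  show "n \<le> m" if "x \<in> grade A m" for m
    using component_homogeneous[OF assms(1), of m] component_homogeneous[OF that, of m] assms(2)
    by (auto split: if_splits)
qed fact

text \<open>An additive property passes from the components to the whole element. The homogeneous case
  concerns only the components of the given \<open>x\<close>, so that what is known about them, for instance
  that they are cycles, can be used there.\<close>

lemma homogeneous_induct [consumes 1, case_names zero homogeneous add]: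
  assumes x: "x \<in> carrier A"
    and zero: "P \<zero>\<^bsub>A\<^esub>"
    and homogeneous: "\<And>i. P (component A x i)"
    and add: "\<And>y z. \<lbrakk>y \<in> carrier A; z \<in> carrier A; P y; P z\<rbrakk> \<Longrightarrow> P (y \<oplus>\<^bsub>A\<^esub> z)"
  shows "P x"
proof -
  have "P (\<Oplus>\<^bsub>A\<^esub>i\<in>I. component A x i)" if "finite I" for I
    using that
  proof (induct I)
    case (insert j I)
    thus ?case using component_closed[OF x] homogeneous
      by (simp add: Pi_def add M.finsum_closed)
  qed (simp add: zero)
  thus ?thesis using finite_component[OF x] sum_component[OF x] by metis
qed

lemma component_diff:
  assumes "x \<in> carrier A"
  shows "component A (diff A x) i = diff A (component A x (Suc i))"
  using assms
proof (induct rule: homogeneous_induct)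
  interpret d: abelian_group_hom A A "diff A" by (rule diff_hom)
  case zero
  show ?case using component_homogeneous[OF grade_zero] d.hom_zero by simp
next
  interpret d: abelian_group_hom A A "diff A" by (rule diff_hom)
  case (homogeneous j)
  have g: "component A x j \<in> grade A j" using assms by (rule component_grade)
  show ?case
  proof (cases j)
    case 0
    thus ?thesis using g diff_grade_0[of "component A x j"] d.hom_zero component_homogeneous[OF grade_zero]
      by (simp add: component_homogeneous)
  next
    case (Suc n)
    with g have "diff A (component A x j) \<in> grade A n" by (simp add: diff_grade_Suc)
    with Suc show ?thesis using d.hom_zero
      by (simp add: component_homogeneous[OF g[unfolded Suc]] component_homogeneous)
  qed
next
  case (add y z)
  thus ?case by (simp add: component_add diff_closed component_closed diff_add)
qed

text \<open>Multiplication by an element of degree zero preserves degrees; hence the degree-zero homology acts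
  on the part of positive degree (\<open>homology_grade_0_mult_pos\<close>).\<close>

lemma component_mult_grade_0:
  assumes c: "c \<in> grade A 0" and x: "x \<in> carrier A"
  shows "component A (c \<otimes>\<^bsub>A\<^esub> x) i = c \<otimes>\<^bsub>A\<^esub> component A x i"
  using x
proof (induct rule: homogeneous_induct)
  case zero
  show ?case using grade_subset[OF c] component_homogeneous[OF grade_zero] by simp
next
  case (homogeneous j)
  have g: "component A x j \<in> grade A j" using x by (rule component_grade)
  have "c \<otimes>\<^bsub>A\<^esub> component A x j \<in> grade A j" using mult_grade[OF c g] by simp
  thus ?case using grade_subset[OF c]
    by (simp add: component_homogeneous[OF g] component_homogeneous)
next
  case (add y z)
  thus ?case using grade_subset[OF c]
    by (simp add: component_add component_closed A.r_distr)
qed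

section \<open>Homology as a quotient ring\<close>

lemma cycles_closed: "z \<in> cycles A \<Longrightarrow> z \<in> carrier A"
  by (simp add: cycles_def)

lemma component_cycle:
  assumes "z \<in> cycles A"
  shows "component A z i \<in> cycles A"
proof (cases i)
  case 0
  thus ?thesis using assms component_grade[of z 0] component_closed[of z 0]
    by (simp add: cycles_def diff_grade_0)
next
  case (Suc n)
  thus ?thesis using assms component_diff[of z n] component_closed[of z i]
      component_homogeneous[OF grade_zero]
    by (simp add: cycles_def)
qed

lemma cycles_additive: "additive_subgroup (cycles A) A"
proof -
  interpret d: abelian_group_hom A A "diff A" by (rule diff_hom)
  have "cycles A = a_kernel A A (diff A)" unfolding cycles_def a_kernel_def' ..
  thus ?thesis using d.additive_subgroup_a_kernel by simp
qed

lemma boundaries_additive: "additive_subgroup (boundaries A) A"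
proof -
  interpret d: abelian_group_hom A A "diff A" by (rule diff_hom)
  show ?thesis unfolding boundaries_def
    using group_hom.img_is_subgroup[OF d.a_group_hom] by (simp add: additive_subgroup_def)
qed

lemma boundaries_subset_cycles: "boundaries A \<subseteq> cycles A"
  by (auto simp: boundaries_def cycles_def diff_closed diff_diff)

lemma signed_signed: "x \<in> carrier A \<Longrightarrow> signed A n (signed A n x) = x"
  by (simp add: signed_def)

lemma signed_mem: "\<lbrakk>additive_subgroup H A; x \<in> H\<rbrakk> \<Longrightarrow> signed A n x \<in> H"
  using M.add.subgroupE(3)[OF additive_subgroup.a_subgroup, of H x]
  by (simp add: signed_def a_inv_def)

text \<open>Reduces closure properties of products to products of homogeneous elements, where the Leibniz rule
  applies: a product is the sum of the products of the components of its factors.\<close>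

lemma mult_mem_of_components:
  assumes H: "additive_subgroup H A" and x: "x \<in> carrier A" and y: "y \<in> carrier A"
    and mem: "\<And>i j. component A x i \<otimes>\<^bsub>A\<^esub> component A y j \<in> H"
  shows "x \<otimes>\<^bsub>A\<^esub> y \<in> H"
proof -
  note [simp] = additive_subgroup.zero_closed[OF H] additive_subgroup.a_closed[OF H]
    component_closed[OF x]
  have left: "component A x i \<otimes>\<^bsub>A\<^esub> y \<in> H" for i
    using y by (induct rule: homogeneous_induct) (auto simp: mem A.r_distr)
  show ?thesis using x
    by (induct rule: homogeneous_induct) (use left in \<open>auto simp: y A.l_distr\<close>)
qed

lemma leibniz_cycle_left:
  assumes "x \<in> grade A i" "x \<in> cycles A" "y \<in> grade A j"
  shows "diff A (x \<otimes>\<^bsub>A\<^esub> y) = signed A i (x \<otimes>\<^bsub>A\<^esub> diff A y)"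
  using leibniz[OF assms(1,3)] assms grade_subset[OF assms(1)] grade_subset[OF assms(3)] diff_closed
  by (simp add: cycles_def signed_def)

lemma leibniz_cycle_right:
  assumes "x \<in> grade A i" "y \<in> grade A j" "y \<in> cycles A"
  shows "diff A (x \<otimes>\<^bsub>A\<^esub> y) = diff A x \<otimes>\<^bsub>A\<^esub> y"
  using leibniz[OF assms(1,2)] assms grade_subset[OF assms(1)] grade_subset[OF assms(2)] diff_closed
  by (simp add: cycles_def signed_def)

lemma cycles_mult:
  assumes x: "x \<in> cycles A" and y: "y \<in> cycles A"
  shows "x \<otimes>\<^bsub>A\<^esub> y \<in> cycles A"
proof (rule mult_mem_of_components[OF cycles_additive])
  fix i j
  have "diff A (component A x i \<otimes>\<^bsub>A\<^esub> component A y j) = \<zero>\<^bsub>A\<^esub>"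
    using component_cycle[OF x, of i] component_cycle[OF y, of j] component_grade x y
    by (subst leibniz_cycle_right[of _ i _ j]) (auto simp: cycles_def)
  thus "component A x i \<otimes>\<^bsub>A\<^esub> component A y j \<in> cycles A"
    using x y component_closed by (simp add: cycles_def)
qed (use x y cycles_closed in auto)

text \<open>For homogeneous \<open>x\<close> with \<open>d x = 0\<close>, the product \<open>x (d w)\<close> is up to sign the boundary of \<open>x w\<close>.\<close>

lemma cycle_mult_boundary:
  assumes x: "x \<in> cycles A" and b: "b \<in> boundaries A"
  shows "x \<otimes>\<^bsub>A\<^esub> b \<in> boundaries A"
proof -
  obtain w where w: "w \<in> carrier A" "b = diff A w" using b by (auto simp: boundaries_def)
  show ?thesis
  proof (rule mult_mem_of_components[OF boundaries_additive])
    fix i j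
    let ?x = "component A x i" and ?w = "component A w (Suc j)"
    have closed: "?x \<in> carrier A" "?w \<in> carrier A"
      using component_closed[OF cycles_closed[OF x]] component_closed[OF w(1)] .
    have "signed A i (diff A (?x \<otimes>\<^bsub>A\<^esub> ?w)) = signed A i (signed A i (?x \<otimes>\<^bsub>A\<^esub> diff A ?w))"
      using component_grade[OF cycles_closed[OF x]] component_cycle[OF x] component_grade[OF w(1)]
      by (simp add: leibniz_cycle_left[of _ i _ "Suc j"])
    also have "\<dots> = ?x \<otimes>\<^bsub>A\<^esub> component A b j"
      using closed w diff_closed by (simp add: signed_signed component_diff)
    finally have "?x \<otimes>\<^bsub>A\<^esub> component A b j = signed A i (diff A (?x \<otimes>\<^bsub>A\<^esub> ?w))" ..
    moreover have "diff A (?x \<otimes>\<^bsub>A\<^esub> ?w) \<in> boundaries A"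
      using closed by (simp add: boundaries_def)
    ultimately show "?x \<otimes>\<^bsub>A\<^esub> component A b j \<in> boundaries A"
      using signed_mem[OF boundaries_additive] by simp
  qed (use x w cycles_closed diff_closed in auto)
qed

lemma boundary_mult_cycle:
  assumes b: "b \<in> boundaries A" and y: "y \<in> cycles A"
  shows "b \<otimes>\<^bsub>A\<^esub> y \<in> boundaries A"
proof -
  obtain w where w: "w \<in> carrier A" "b = diff A w" using b by (auto simp: boundaries_def)
  show ?thesis
  proof (rule mult_mem_of_components[OF boundaries_additive])
    fix i j
    let ?w = "component A w (Suc i)" and ?y = "component A y j"
    have "component A b i \<otimes>\<^bsub>A\<^esub> ?y = diff A (?w \<otimes>\<^bsub>A\<^esub> ?y)"
      using component_grade[OF w(1)] component_grade[OF cycles_closed[OF y]] component_cycle[OF y] w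
      by (simp add: leibniz_cycle_right[of _ "Suc i" _ j] component_diff)
    thus "component A b i \<otimes>\<^bsub>A\<^esub> ?y \<in> boundaries A"
      using y w cycles_closed component_closed by (simp add: boundaries_def)
  qed (use y w cycles_closed diff_closed in auto)
qed

lemma cycles_subring: "subring (cycles A) A"
proof (rule A.subringI)
  show "\<one>\<^bsub>A\<^esub> \<in> cycles A" by (simp add: cycles_def diff_grade_0 one_grade)
  show "\<ominus>\<^bsub>A\<^esub> z \<in> cycles A" if "z \<in> cycles A" for z
    using signed_mem[OF cycles_additive that, of 1] by (simp add: signed_def)
qed (auto intro: cycles_closed cycles_mult additive_subgroup.a_closed[OF cycles_additive])

lemma boundaries_ideal: "ideal (boundaries A) (A\<lparr>carrier := cycles A\<rparr>)"
proof (rule idealI)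
  show "ring (A\<lparr>carrier := cycles A\<rparr>)" by (rule A.subring_is_ring[OF cycles_subring])
  show "subgroup (boundaries A) (add_monoid (A\<lparr>carrier := cycles A\<rparr>))"
    using M.add.subgroup_incl[OF _ _ boundaries_subset_cycles]
      additive_subgroup.a_subgroup[OF cycles_additive]
      additive_subgroup.a_subgroup[OF boundaries_additive]
    by simp
qed (auto intro: cycle_mult_boundary boundary_mult_cycle)

lemma hclass_hom: "ring_hom_ring (A\<lparr>carrier := cycles A\<rparr>) (homology A) (hclass A)"
proof -
  have "hclass A = (+>\<^bsub>A\<lparr>carrier := cycles A\<rparr>\<^esub>) (boundaries A)"
    by (simp add: fun_eq_iff hclass_def a_r_coset_def r_coset_def)
  thus ?thesis using ideal.rcos_ring_hom_ring[OF boundaries_ideal] by (simp add: homology_def)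
qed

lemma hclass_add:
  "\<lbrakk>x \<in> cycles A; y \<in> cycles A\<rbrakk> \<Longrightarrow>
    hclass A (x \<oplus>\<^bsub>A\<^esub> y) = hclass A x \<oplus>\<^bsub>homology A\<^esub> hclass A y"
  using ring_hom_add[OF ring_hom_ring.homh[OF hclass_hom], of x y] by simp

lemma hclass_mult:
  "\<lbrakk>x \<in> cycles A; y \<in> cycles A\<rbrakk> \<Longrightarrow>
    hclass A (x \<otimes>\<^bsub>A\<^esub> y) = hclass A x \<otimes>\<^bsub>homology A\<^esub> hclass A y"
  using ring_hom_mult[OF ring_hom_ring.homh[OF hclass_hom], of x y] by simp

lemma homology_ring: "ring (homology A)"
  using ring_hom_ring.axioms(2)[OF hclass_hom] .

lemma carrier_homology: "carrier (homology A) = hclass A ` cycles A"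
  by (auto simp: homology_def FactRing_def A_RCOSETS_def RCOSETS_def hclass_def a_r_coset_def
      r_coset_def)

lemma zero_homology: "\<zero>\<^bsub>homology A\<^esub> = boundaries A"
  by (simp add: homology_def FactRing_def)

lemma zero_cycle: "\<zero>\<^bsub>A\<^esub> \<in> cycles A"
  by (rule additive_subgroup.zero_closed[OF cycles_additive])

lemma zero_boundary: "\<zero>\<^bsub>A\<^esub> \<in> boundaries A"
  by (rule additive_subgroup.zero_closed[OF boundaries_additive])

lemma hclass_eq_zero_iff:
  assumes z: "z \<in> cycles A"
  shows "hclass A z = \<zero>\<^bsub>homology A\<^esub> \<longleftrightarrow> z \<in> boundaries A"
proof
  have sub: "abelian_subgroup (boundaries A) A"
    using boundaries_additive M.abelian_group_axioms by (rule abelian_subgroupI3)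
  show "hclass A z = \<zero>\<^bsub>homology A\<^esub>" if "z \<in> boundaries A"
    using abelian_subgroup.a_rcos_const[OF sub that] by (simp add: hclass_def zero_homology)
  assume "hclass A z = \<zero>\<^bsub>homology A\<^esub>"
  thus "z \<in> boundaries A"
    using abelian_subgroup.a_rcos_self[OF sub cycles_closed[OF z]]
    by (simp add: hclass_def zero_homology)
qed

lemma homology_grade_closed: "homology_grade A n \<subseteq> carrier (homology A)"
  by (auto simp: homology_grade_def carrier_homology)

lemma hclass_finsum:
  assumes "\<And>i. i \<in> I \<Longrightarrow> z i \<in> cycles A" and "finite I"
  shows "(\<Oplus>\<^bsub>A\<^esub>i\<in>I. z i) \<in> cycles A"
    and "hclass A (\<Oplus>\<^bsub>A\<^esub>i\<in>I. z i) = (\<Oplus>\<^bsub>homology A\<^esub>i\<in>I. hclass A (z i))"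
proof -
  interpret H: ring "homology A" by (rule homology_ring)
  have "(\<Oplus>\<^bsub>A\<^esub>i\<in>I. z i) \<in> cycles A \<and>
    hclass A (\<Oplus>\<^bsub>A\<^esub>i\<in>I. z i) = (\<Oplus>\<^bsub>homology A\<^esub>i\<in>I. hclass A (z i))"
    using assms(2,1)
  proof (induct I)
    case empty
    show ?case using zero_cycle zero_boundary by (simp add: hclass_eq_zero_iff)
  next
    case (insert j I)
    have "(\<Oplus>\<^bsub>A\<^esub>i\<in>insert j I. z i) = z j \<oplus>\<^bsub>A\<^esub> (\<Oplus>\<^bsub>A\<^esub>i\<in>I. z i)"
      using insert.hyps insert.prems cycles_closed by (intro M.finsum_insert) auto
    moreover have "(\<Oplus>\<^bsub>homology A\<^esub>i\<in>insert j I. hclass A (z i))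
        = hclass A (z j) \<oplus>\<^bsub>homology A\<^esub> (\<Oplus>\<^bsub>homology A\<^esub>i\<in>I. hclass A (z i))"
      using insert.hyps insert.prems by (intro H.finsum_insert) (auto simp: carrier_homology)
    ultimately show ?case
      using insert by (simp add: hclass_add additive_subgroup.a_closed[OF cycles_additive])
  qed
  thus "(\<Oplus>\<^bsub>A\<^esub>i\<in>I. z i) \<in> cycles A"
    and "hclass A (\<Oplus>\<^bsub>A\<^esub>i\<in>I. z i) = (\<Oplus>\<^bsub>homology A\<^esub>i\<in>I. hclass A (z i))" by auto
qed

text \<open>A description of positive-degree homology by cycles: a sum of classes of positive degree is
  represented by a cycle whose component in degree zero vanishes, and such a cycle is the sum of its
  components, which are cycles of positive degree. Closure under the operations is immediate in this
  form.\<close>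

lemma homology_pos_eq: "homology_pos A = hclass A ` {z \<in> cycles A. component A z 0 = \<zero>\<^bsub>A\<^esub>}"
proof (intro subset_antisym subsetI)
  fix h assume "h \<in> homology_pos A"
  then obtain I g where I: "finite I" "I \<subseteq> {1..}" "\<forall>i\<in>I. g i \<in> homology_grade A i"
    and h: "h = (\<Oplus>\<^bsub>homology A\<^esub>i\<in>I. g i)"
    by (auto simp: homology_pos_def)
  from I(3) have "\<forall>i\<in>I. \<exists>z. z \<in> cycles A \<inter> grade A i \<and> g i = hclass A z"
    by (auto simp: homology_grade_def)
  then obtain z where z: "\<And>i. i \<in> I \<Longrightarrow> z i \<in> cycles A \<and> z i \<in> grade A i \<and> g i = hclass A (z i)"
    by (metis IntE)
  interpret H: ring "homology A" by (rule homology_ring)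
  interpret c: abelian_group_hom A A "\<lambda>x. component A x 0" by (rule component_hom)
  have "h = (\<Oplus>\<^bsub>homology A\<^esub>i\<in>I. hclass A (z i))"
    unfolding h using z by (intro H.finsum_cong') (auto simp: carrier_homology)
  also have "\<dots> = hclass A (\<Oplus>\<^bsub>A\<^esub>i\<in>I. z i)" using hclass_finsum(2)[of I z] z I by simp
  finally have "h = hclass A (\<Oplus>\<^bsub>A\<^esub>i\<in>I. z i)" .
  moreover have "component A (\<Oplus>\<^bsub>A\<^esub>i\<in>I. z i) 0 = (\<Oplus>\<^bsub>A\<^esub>i\<in>I. component A (z i) 0)"
    using z cycles_closed by (intro c.hom_finsum) auto
  moreover have "\<dots> = (\<Oplus>\<^bsub>A\<^esub>i\<in>I. \<zero>\<^bsub>A\<^esub>)"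
    using z I(2) by (intro M.finsum_cong') (fastforce simp: component_homogeneous[of _ i for i])+
  ultimately show "h \<in> hclass A ` {z \<in> cycles A. component A z 0 = \<zero>\<^bsub>A\<^esub>}"
    using hclass_finsum(1)[of I z] z I(1) by auto
next
  fix h assume "h \<in> hclass A ` {z \<in> cycles A. component A z 0 = \<zero>\<^bsub>A\<^esub>}"
  then obtain z where z: "z \<in> cycles A" "component A z 0 = \<zero>\<^bsub>A\<^esub>" "h = hclass A z" by auto
  let ?I = "{i. component A z i \<noteq> \<zero>\<^bsub>A\<^esub>}"
  have fin: "finite ?I" using z(1) cycles_closed finite_component by blast
  have "h = (\<Oplus>\<^bsub>homology A\<^esub>i\<in>?I. hclass A (component A z i))"
    using hclass_finsum(2)[of ?I "component A z"] fin component_cycle[OF z(1)]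
      sum_component[OF cycles_closed[OF z(1)]] z(3)
    by simp
  moreover have "?I \<subseteq> {1..}" using z(2) by (auto simp: Suc_le_eq intro!: gr0I)
  moreover have "\<forall>i\<in>?I. hclass A (component A z i) \<in> homology_grade A i"
    using component_cycle[OF z(1)] component_grade[OF cycles_closed[OF z(1)]]
    by (auto simp: homology_grade_def)
  ultimately show "h \<in> homology_pos A" using fin unfolding homology_pos_def by blast
qed

lemma homology_pos_closed: "homology_pos A \<subseteq> carrier (homology A)"
  by (auto simp: homology_pos_eq carrier_homology)

lemma homology_pos_group: "abelian_group ((homology_space \<epsilon> A)\<lparr>carrier := homology_pos A\<rparr>)"
proof -
  interpret H: ring "homology A" by (rule homology_ring)
  have closed: "h \<in> carrier (homology A)" if "h \<in> homology_pos A" for h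
    using that homology_pos_closed by blast
  show ?thesis
  proof (rule abelian_groupI, unfold homology_space_def, simp_all)
    show "g \<oplus>\<^bsub>homology A\<^esub> h \<in> homology_pos A"
      if gh: "g \<in> homology_pos A" "h \<in> homology_pos A" for g h
    proof -
      obtain x y where "x \<in> cycles A" "component A x 0 = \<zero>\<^bsub>A\<^esub>" "g = hclass A x"
          "y \<in> cycles A" "component A y 0 = \<zero>\<^bsub>A\<^esub>" "h = hclass A y"
        using gh by (auto simp: homology_pos_eq)
      thus ?thesis
        using additive_subgroup.a_closed[OF cycles_additive, of x y] cycles_closed
        by (auto simp: homology_pos_eq hclass_add[symmetric] component_add)
    qed
    show "\<zero>\<^bsub>homology A\<^esub> \<in> homology_pos A"
      using zero_cycle zero_boundary hclass_eq_zero_iff component_homogeneous[OF grade_zero]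
      by (auto simp: homology_pos_eq image_iff intro!: exI[of _ "\<zero>\<^bsub>A\<^esub>"])
    show "\<exists>g\<in>homology_pos A. g \<oplus>\<^bsub>homology A\<^esub> h = \<zero>\<^bsub>homology A\<^esub>"
      if h: "h \<in> homology_pos A" for h
    proof -
      obtain z where z: "z \<in> cycles A" "component A z 0 = \<zero>\<^bsub>A\<^esub>" "h = hclass A z"
        using h by (auto simp: homology_pos_eq)
      interpret c: abelian_group_hom A A "\<lambda>x. component A x 0" by (rule component_hom)
      have neg: "\<ominus>\<^bsub>A\<^esub> z \<in> cycles A"
        using signed_mem[OF cycles_additive z(1), of 1] by (simp add: signed_def)
      have "component A (\<ominus>\<^bsub>A\<^esub> z) 0 = \<zero>\<^bsub>A\<^esub>"
        using c.hom_a_inv[OF cycles_closed[OF z(1)]] z(2) by simp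
      moreover have "hclass A (\<ominus>\<^bsub>A\<^esub> z) \<oplus>\<^bsub>homology A\<^esub> h = \<zero>\<^bsub>homology A\<^esub>"
        using hclass_add[OF neg z(1)] hclass_eq_zero_iff[OF zero_cycle] zero_boundary
          cycles_closed[OF z(1)] by (simp add: z(3) M.l_neg)
      ultimately show ?thesis using neg by (auto simp: homology_pos_eq)
    qed
      show "g \<oplus>\<^bsub>homology A\<^esub> h = h \<oplus>\<^bsub>homology A\<^esub> g"
      if "g \<in> homology_pos A" "h \<in> homology_pos A" for g h
      using that closed H.a_comm by blast
  qed (simp_all add: closed H.a_assoc)
qed

lemma homology_grade_0_mult_pos:
  assumes "e \<in> homology_grade A 0" "h \<in> homology_pos A"
  shows "e \<otimes>\<^bsub>homology A\<^esub> h \<in> homology_pos A"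
proof -
  obtain c z where cz: "c \<in> cycles A" "c \<in> grade A 0" "e = hclass A c"
      "z \<in> cycles A" "component A z 0 = \<zero>\<^bsub>A\<^esub>" "h = hclass A z"
    using assms by (auto simp: homology_pos_eq homology_grade_def)
  hence "component A (c \<otimes>\<^bsub>A\<^esub> z) 0 = \<zero>\<^bsub>A\<^esub>"
    using cycles_closed by (simp add: component_mult_grade_0)
  thus ?thesis using cz cycles_mult by (auto simp: homology_pos_eq hclass_mult[symmetric])
qed

end

lemma words_image: "words (f ` X) = map f ` words X"
proof -
  have "words X = lists X - {[]}" "words (f ` X) = lists (f ` X) - {[]}"
    by (auto simp: words_def)
  thus ?thesis by (auto simp: lists_image)
qed

text \<open>The values of \<open>\<mu>'\<close> are prescribed along the injective map that \<open>\<phi>\<^sub>*\<close> induces on words.\<close>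

lemma unique_extensional_lift:
  assumes inj: "inj_on f X" and g: "\<And>x. x \<in> X \<Longrightarrow> g x \<in> C"
  shows "\<exists>!h. h \<in> f ` X \<rightarrow>\<^sub>E C \<and> (\<forall>x\<in>X. h (f x) = g x)"
proof
  let ?h = "restrict (g \<circ> the_inv_into X f) (f ` X)"
  show "?h \<in> f ` X \<rightarrow>\<^sub>E C \<and> (\<forall>x\<in>X. ?h (f x) = g x)"
    using g by (auto simp: the_inv_into_f_f[OF inj])
  show "h = ?h" if "h \<in> f ` X \<rightarrow>\<^sub>E C \<and> (\<forall>x\<in>X. h (f x) = g x)" for h
    using that by (intro PiE_ext[of h "f ` X" "\<lambda>_. C"]) (auto simp: g the_inv_into_f_f[OF inj])
qed

section \<open>Morphisms and quasi-isomorphisms\<close>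

locale dg_algebra_hom = A: dg_algebra R A + B: dg_algebra S B
  for R :: "('r, 'p) ring_scheme" and A :: "('r, 'a, 'm) dg_algebra_scheme"
    and S :: "('s, 'q) ring_scheme" and B :: "('s, 'b, 'n) dg_algebra_scheme" +
  fixes \<phi> :: "'a \<Rightarrow> 'b"
  assumes morphism: "dg_morphism A B \<phi>"
begin

sublocale phi: ring_hom_ring A B \<phi>
  using morphism by (intro ring_hom_ringI2 A.A.ring_axioms B.A.ring_axioms) (simp add: dg_morphism_def)

abbreviation phi_star ("\<phi>\<^sub>*") where "\<phi>\<^sub>* \<equiv> homology_map A B \<phi>"

lemma phi_grade: "x \<in> grade A i \<Longrightarrow> \<phi> x \<in> grade B i"
  using morphism by (simp add: dg_morphism_def)

lemma phi_diff: "x \<in> carrier A \<Longrightarrow> \<phi> (diff A x) = diff B (\<phi> x)"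
  using morphism by (simp add: dg_morphism_def)

lemma phi_cycle: "z \<in> cycles A \<Longrightarrow> \<phi> z \<in> cycles B"
  using phi_diff[of z] by (simp add: cycles_def)

lemma phi_boundary: "b \<in> boundaries A \<Longrightarrow> \<phi> b \<in> boundaries B"
  by (auto simp: boundaries_def phi_diff)

text \<open>A degree-preserving additive map commutes with the projections.\<close>

lemma phi_component:
  assumes "x \<in> carrier A"
  shows "component B (\<phi> x) i = \<phi> (component A x i)"
  using assms
proof (induct rule: A.homogeneous_induct)
  case zero
  show ?case using A.component_homogeneous[OF A.grade_zero] B.component_homogeneous[OF B.grade_zero]
    by simp
next
  case (homogeneous j)
  have g: "component A x j \<in> grade A j" using assms by (rule A.component_grade)
  show ?case by (simp add: A.component_homogeneous[OF g] B.component_homogeneous[OF phi_grade[OF g]])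
next
  case (add y z)
  thus ?case by (simp add: A.component_add B.component_add A.component_closed)
qed

text \<open>If \<open>\<phi> x\<close> is zero, its degree is by convention zero and may differ from that of \<open>x\<close>, but then both
  sides vanish; otherwise \<open>x\<close> and \<open>\<phi> x\<close> have the same degree.\<close>

lemma phi_bar:
  assumes "x \<in> grade A i"
  shows "bar B (\<phi> x) = \<phi> (bar A x)"
proof (cases "\<phi> x = \<zero>\<^bsub>B\<^esub>")
  case True
  thus ?thesis using A.grade_subset[OF assms] by (simp add: bar_def signed_def)
next
  case False
  hence "x \<noteq> \<zero>\<^bsub>A\<^esub>" by auto
  with False show ?thesis
    using A.grade_subset[OF assms] A.hdeg_grade[OF assms] B.hdeg_grade[OF phi_grade[OF assms]]
    by (simp add: bar_def signed_def)
qed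

lemma homology_map_hclass:
  assumes z: "z \<in> cycles A"
  shows "\<phi>\<^sub>* (hclass A z) = hclass B (\<phi> z)"
proof -
  interpret HB: ring "homology B" by (rule B.homology_ring)
  have repr: "hclass A z = (\<lambda>b. b \<oplus>\<^bsub>A\<^esub> z) ` boundaries A"
    by (auto simp: hclass_def a_r_coset_def r_coset_def)
  have "hclass B (\<phi> y) = hclass B (\<phi> z)" if y: "y \<in> hclass A z" for y
  proof -
    obtain b where b: "b \<in> boundaries A" "y = b \<oplus>\<^bsub>A\<^esub> z" using y repr by auto
    have bc: "b \<in> cycles A" using b A.boundaries_subset_cycles by blast
    have "hclass B (\<phi> y) = hclass B (\<phi> b) \<oplus>\<^bsub>homology B\<^esub> hclass B (\<phi> z)"
      using b bc z A.cycles_closed by (simp add: B.hclass_add phi_cycle)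
    also have "hclass B (\<phi> b) = \<zero>\<^bsub>homology B\<^esub>"
      using b bc B.hclass_eq_zero_iff phi_boundary phi_cycle by blast
    finally show ?thesis using phi_cycle[OF z] by (simp add: B.carrier_homology)
  qed
  moreover have "hclass A z \<noteq> {}" using A.zero_boundary by (auto simp: repr)
  ultimately show ?thesis unfolding homology_map_def by (rule the_elem_image_unique[rotated])
qed

lemma homology_map_hom: "abelian_group_hom (homology A) (homology B) \<phi>\<^sub>*"
proof (rule abelian_group_homI')
  show "abelian_group (homology A)" "abelian_group (homology B)"
    using A.homology_ring B.homology_ring by (auto simp: ring_def)
  show "\<phi>\<^sub>* h \<in> carrier (homology B)" if "h \<in> carrier (homology A)" for h
    using that phi_cycle by (auto simp: A.carrier_homology B.carrier_homology homology_map_hclass)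
  show "\<phi>\<^sub>* (g \<oplus>\<^bsub>homology A\<^esub> h) = \<phi>\<^sub>* g \<oplus>\<^bsub>homology B\<^esub> \<phi>\<^sub>* h"
    if gh: "g \<in> carrier (homology A)" "h \<in> carrier (homology A)" for g h
  proof -
    obtain x y where xy: "x \<in> cycles A" "g = hclass A x" "y \<in> cycles A" "h = hclass A y"
      using gh by (auto simp: A.carrier_homology)
    moreover have "x \<oplus>\<^bsub>A\<^esub> y \<in> cycles A"
      using xy additive_subgroup.a_closed[OF A.cycles_additive] by blast
    ultimately show ?thesis using A.cycles_closed phi_cycle
      by (simp add: A.hclass_add[symmetric] B.hclass_add[symmetric] homology_map_hclass)
  qed
qed

end

locale dg_quasi_iso = dg_algebra_hom +
  assumes quasi_iso: "quasi_iso A B \<phi>"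
begin

lemma homology_map_grade_bij: "bij_betw \<phi>\<^sub>* (homology_grade A n) (homology_grade B n)"
  using quasi_iso by (simp add: quasi_iso_def)

text \<open>The injectivity of \<open>\<phi>\<^sub>*\<close> on total homology in terms of cycles. Comparing the components of \<open>\<phi> z\<close>
  and \<open>d w\<close> reduces it to the injectivity in each degree.\<close>

lemma phi_reflects_boundaries:
  assumes z: "z \<in> cycles A" and b: "\<phi> z \<in> boundaries B"
  shows "z \<in> boundaries A"
proof -
  have zA: "z \<in> carrier A" using z by (rule A.cycles_closed)
  obtain w where w: "w \<in> carrier B" "\<phi> z = diff B w" using b by (auto simp: boundaries_def)
  have comp: "component A z i \<in> boundaries A" for i
  proof -
    let ?z = "component A z i"
    have zi: "?z \<in> cycles A" "?z \<in> grade A i"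
      using A.component_cycle[OF z] A.component_grade[OF zA] by auto
    have "\<phi> ?z = diff B (component B w (Suc i))"
      using w phi_component[OF zA, of i] by (simp add: B.component_diff)
    hence "\<phi> ?z \<in> boundaries B" using B.component_closed[OF w(1)] by (simp add: boundaries_def)
    hence "\<phi>\<^sub>* (hclass A ?z) = \<phi>\<^sub>* (hclass A \<zero>\<^bsub>A\<^esub>)"
      using zi A.zero_cycle B.hclass_eq_zero_iff[OF phi_cycle] B.hclass_eq_zero_iff[OF B.zero_cycle]
        B.zero_boundary
      by (simp add: homology_map_hclass)
    moreover have "hclass A ?z \<in> homology_grade A i" "hclass A \<zero>\<^bsub>A\<^esub> \<in> homology_grade A i"
      using zi A.zero_cycle A.grade_zero by (auto simp: homology_grade_def)
    ultimately have "hclass A ?z = hclass A \<zero>\<^bsub>A\<^esub>"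
      using homology_map_grade_bij[of i] by (meson bij_betw_imp_inj_on inj_onD)
    thus ?thesis
      using zi A.zero_cycle A.zero_boundary A.hclass_eq_zero_iff by metis
  qed
  show ?thesis using zA
  proof (induct rule: A.homogeneous_induct)
    case zero show ?case by (rule A.zero_boundary)
  next
    case (homogeneous i) show ?case by (rule comp)
  next
    case (add x y) thus ?case using additive_subgroup.a_closed[OF A.boundaries_additive] by blast
  qed
qed

lemma homology_map_inj: "inj_on \<phi>\<^sub>* (carrier (homology A))"
proof -
  interpret H: abelian_group_hom "homology A" "homology B" "\<phi>\<^sub>*" by (rule homology_map_hom)
  have "h = \<zero>\<^bsub>homology A\<^esub>" if h: "h \<in> carrier (homology A)" "\<phi>\<^sub>* h = \<zero>\<^bsub>homology B\<^esub>" for h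
  proof -
    obtain z where z: "z \<in> cycles A" "h = hclass A z" using h by (auto simp: A.carrier_homology)
    hence "\<phi> z \<in> boundaries B"
      using h B.hclass_eq_zero_iff[OF phi_cycle] by (simp add: homology_map_hclass)
    thus ?thesis using z phi_reflects_boundaries A.hclass_eq_zero_iff by blast
  qed
  thus ?thesis using group_hom.inj_on_one_iff[OF H.a_group_hom] by simp
qed

text \<open>A class mapped to degree \<open>n\<close> has the same image as some class of degree \<open>n\<close>, by surjectivity in
  that degree, and equals it by injectivity on total homology.\<close>

lemma homology_map_mem_grade_iff:
  assumes "h \<in> carrier (homology A)"
  shows "\<phi>\<^sub>* h \<in> homology_grade B n \<longleftrightarrow> h \<in> homology_grade A n"
proof
  assume "\<phi>\<^sub>* h \<in> homology_grade B n"
  then obtain g where g: "g \<in> homology_grade A n" "\<phi>\<^sub>* h = \<phi>\<^sub>* g"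
    using homology_map_grade_bij[of n] by (auto simp: bij_betw_def)
  hence "h = g" using assms homology_map_inj A.homology_grade_closed by (meson inj_onD subsetD)
  with g show "h \<in> homology_grade A n" by simp
qed (use homology_map_grade_bij[of n] in \<open>auto simp: bij_betw_def\<close>)

lemma hdeg_homology_map:
  "h \<in> carrier (homology A) \<Longrightarrow> hdeg (homology_grade B) (\<phi>\<^sub>* h) = hdeg (homology_grade A) h"
  by (simp add: hdeg_def homology_map_mem_grade_iff)

lemma homology_map_pos_bij: "bij_betw \<phi>\<^sub>* (homology_pos A) (homology_pos B)"
proof -
  interpret H: abelian_group_hom "homology A" "homology B" "\<phi>\<^sub>*" by (rule homology_map_hom)
  have sum: "\<phi>\<^sub>* (\<Oplus>\<^bsub>homology A\<^esub>i\<in>I. g i) = (\<Oplus>\<^bsub>homology B\<^esub>i\<in>I. \<phi>\<^sub>* (g i))"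
    if "\<forall>i\<in>I. g i \<in> homology_grade A i" for I g
    using that A.homology_grade_closed by (intro H.hom_finsum) blast
  have "\<phi>\<^sub>* ` homology_pos A = homology_pos B"
  proof (intro subset_antisym subsetI)
    fix y assume "y \<in> \<phi>\<^sub>* ` homology_pos A"
    then obtain I g where I: "finite I" "I \<subseteq> {1..}" "\<forall>i\<in>I. g i \<in> homology_grade A i"
      and y: "y = \<phi>\<^sub>* (\<Oplus>\<^bsub>homology A\<^esub>i\<in>I. g i)"
      by (auto simp: homology_pos_def)
    have "\<forall>i\<in>I. \<phi>\<^sub>* (g i) \<in> homology_grade B i"
      using I(3) homology_map_grade_bij by (auto simp: bij_betw_def)
    with I y sum[OF I(3)] show "y \<in> homology_pos B" unfolding homology_pos_def by blast
  next
    fix y assume "y \<in> homology_pos B"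
    then obtain I g where I: "finite I" "I \<subseteq> {1..}" "\<forall>i\<in>I. g i \<in> homology_grade B i"
      and y: "y = (\<Oplus>\<^bsub>homology B\<^esub>i\<in>I. g i)"
      by (auto simp: homology_pos_def)
    have "\<forall>i\<in>I. \<exists>f. f \<in> homology_grade A i \<and> g i = \<phi>\<^sub>* f"
      using I(3) homology_map_grade_bij[THEN bij_betw_imp_surj_on] by blast
    then obtain f where f: "\<And>i. i \<in> I \<Longrightarrow> f i \<in> homology_grade A i \<and> g i = \<phi>\<^sub>* (f i)" by metis
    have "y = (\<Oplus>\<^bsub>homology B\<^esub>i\<in>I. \<phi>\<^sub>* (f i))"
      unfolding y using f A.homology_grade_closed H.hom_closed
      by (intro H.H.finsum_cong') blast+
    hence "y = \<phi>\<^sub>* (\<Oplus>\<^bsub>homology A\<^esub>i\<in>I. f i)" using sum[of I f] f by simp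
    moreover have "(\<Oplus>\<^bsub>homology A\<^esub>i\<in>I. f i) \<in> homology_pos A"
      using I(1,2) f unfolding homology_pos_def by blast
    ultimately show "y \<in> \<phi>\<^sub>* ` homology_pos A" by blast
  qed
  thus ?thesis
    using homology_map_inj A.homology_pos_closed by (auto simp: bij_betw_def intro: inj_on_subset)
qed

lemma homogeneous_basis_image:
  assumes \<epsilon>: "\<And>c. c \<in> carrier k \<Longrightarrow> \<epsilon>A c \<in> homology_grade A 0"
    and linear: "\<And>c h. \<lbrakk>c \<in> carrier k; h \<in> carrier (homology A)\<rbrakk> \<Longrightarrow>
      \<phi>\<^sub>* (\<epsilon>A c \<otimes>\<^bsub>homology A\<^esub> h) = \<epsilon>B c \<otimes>\<^bsub>homology B\<^esub> \<phi>\<^sub>* h"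
    and basis: "homogeneous_basis k \<epsilon>A A \<B>"
  shows "homogeneous_basis k \<epsilon>B B (\<phi>\<^sub>* ` \<B>)"
proof -
  let ?M = "(homology_space \<epsilon>A A)\<lparr>carrier := homology_pos A\<rparr>"
  let ?N = "(homology_space \<epsilon>B B)\<lparr>carrier := homology_pos B\<rparr>"
  interpret H: abelian_group_hom "homology A" "homology B" "\<phi>\<^sub>*" by (rule homology_map_hom)
  have pos: "h \<in> carrier (homology A)" if "h \<in> homology_pos A" for h
    using that A.homology_pos_closed by blast
  have "\<phi>\<^sub>* ` \<B> \<subseteq> (\<Union>n\<in>{1..}. homology_grade B n)"
    using basis homology_map_grade_bij unfolding homogeneous_basis_def bij_betw_def by blast
  moreover have "module_basis k ?N (\<phi>\<^sub>* ` \<B>)"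
  proof (rule module_basis_image)
    show "abelian_group_hom ?M ?N \<phi>\<^sub>*"
    proof (rule abelian_group_homI'[OF A.homology_pos_group B.homology_pos_group])
      show "\<phi>\<^sub>* h \<in> carrier ?N" if "h \<in> carrier ?M" for h
        using that homology_map_pos_bij by (auto simp: bij_betw_def)
    qed (auto simp: homology_space_def pos)
    show "bij_betw \<phi>\<^sub>* (carrier ?M) (carrier ?N)" using homology_map_pos_bij by simp
    show "module_basis k ?M \<B>" using basis by (simp add: homogeneous_basis_def)
    show "c \<odot>\<^bsub>?M\<^esub> h \<in> carrier ?M" if "c \<in> carrier k" "h \<in> carrier ?M" for c h
      using that \<epsilon> A.homology_grade_0_mult_pos by (simp add: homology_space_def)
    show "\<phi>\<^sub>* (c \<odot>\<^bsub>?M\<^esub> h) = c \<odot>\<^bsub>?N\<^esub> \<phi>\<^sub>* h" if "c \<in> carrier k" "h \<in> carrier ?M" for c h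
      using that linear pos by (simp add: homology_space_def)
  qed
  ultimately show ?thesis by (simp add: homogeneous_basis_def)
qed

text \<open>Each condition on the values of \<open>\<mu>'\<close> is the image under \<open>\<phi>\<close> of the corresponding condition on \<open>\<mu>\<close>, because every word
  over the image of \<open>\<B>\<close> is the image of a word over \<open>\<B>\<close>, and so are its two parts wherever it is cut.\<close>

lemma trivial_massey_operation_image:
  assumes basis: "homogeneous_basis k \<epsilon>B B (\<phi>\<^sub>* ` \<B>)"
    and massey: "trivial_massey_operation k \<epsilon>A A \<B> \<mu>"
    and \<mu>': "\<And>hs. hs \<in> words \<B> \<Longrightarrow> \<mu>' (map \<phi>\<^sub>* hs) = \<phi> (\<mu> hs)"
  shows "trivial_massey_operation k \<epsilon>B B (\<phi>\<^sub>* ` \<B>) \<mu>'"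
proof -
  let ?deg = "\<lambda>hs. sum_list (map (hdeg (homology_grade A)) hs) + length hs - 1"
  have "\<B> \<subseteq> homology_pos A"
    using massey by (simp add: trivial_massey_operation_def homogeneous_basis_def module_basis_def)
  hence \<B>: "h \<in> carrier (homology A)" if "h \<in> \<B>" for h
    using that A.homology_pos_closed by blast
  have grade: "\<mu> hs \<in> grade A (?deg hs)" if "hs \<in> words \<B>" for hs
    using massey that by (simp add: trivial_massey_operation_def)
  have "\<mu>' gs \<in> grade B (sum_list (map (hdeg (homology_grade B)) gs) + length gs - 1)"
    if gs: "gs \<in> words (\<phi>\<^sub>* ` \<B>)" for gs
  proof -
    obtain hs where hs: "hs \<in> words \<B>" "gs = map \<phi>\<^sub>* hs" using gs words_image[of "\<phi>\<^sub>*" \<B>] by blast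
    have deg: "map (hdeg (homology_grade B)) gs = map (hdeg (homology_grade A)) hs"
      using hs \<B> by (auto simp: words_def hdeg_homology_map)
    have val: "\<mu>' gs = \<phi> (\<mu> hs)" and len: "length gs = length hs"
      using hs \<mu>' by simp_all
    show ?thesis unfolding deg val len using phi_grade[OF grade[OF hs(1)]] .
  qed
  moreover have "\<mu>' [g] \<in> cycles B \<and> hclass B (\<mu>' [g]) = g" if g: "g \<in> \<phi>\<^sub>* ` \<B>" for g
  proof -
    obtain h where h: "h \<in> \<B>" "g = \<phi>\<^sub>* h" using g by blast
    hence cyc: "\<mu> [h] \<in> cycles A" "hclass A (\<mu> [h]) = h"
      using massey by (auto simp: trivial_massey_operation_def)
    have "\<mu>' [g] = \<phi> (\<mu> [h])" using h \<mu>'[of "[h]"] by (simp add: words_def)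
    with cyc h show ?thesis using phi_cycle homology_map_hclass[OF cyc(1)] by simp
  qed
  moreover have "diff B (\<mu>' gs) =
      (\<Oplus>\<^bsub>B\<^esub>j\<in>{1..<length gs}. bar B (\<mu>' (take j gs)) \<otimes>\<^bsub>B\<^esub> \<mu>' (drop j gs))"
    if gs: "gs \<in> words (\<phi>\<^sub>* ` \<B>)" for gs
  proof -
    obtain hs where hs: "hs \<in> words \<B>" "gs = map \<phi>\<^sub>* hs" using gs words_image[of "\<phi>\<^sub>*" \<B>] by blast
    let ?t = "\<lambda>j. bar A (\<mu> (take j hs)) \<otimes>\<^bsub>A\<^esub> \<mu> (drop j hs)"
    have parts: "take j hs \<in> words \<B>" "drop j hs \<in> words \<B>" if "j \<in> {1..<length hs}" for j
      using that hs(1) set_take_subset[of j hs] set_drop_subset[of j hs] by (auto simp: words_def)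
    have closed: "bar A (\<mu> (take j hs)) \<in> carrier A" "\<mu> (drop j hs) \<in> carrier A"
      if "j \<in> {1..<length hs}" for j
      using A.grade_subset[OF grade[OF parts(1)[OF that]]]
        A.grade_subset[OF grade[OF parts(2)[OF that]]]
      by (auto simp: bar_def signed_def)
    have image: "bar B (\<mu>' (take j gs)) \<otimes>\<^bsub>B\<^esub> \<mu>' (drop j gs) = \<phi> (?t j)"
      if "j \<in> {1..<length hs}" for j
      using parts[OF that] closed[OF that] phi_bar[OF grade[OF parts(1)[OF that]]]
        \<mu>'[OF parts(1)[OF that]] \<mu>'[OF parts(2)[OF that]]
      by (simp add: hs(2) take_map drop_map)
    have "diff B (\<mu>' gs) = \<phi> (diff A (\<mu> hs))"
      using hs \<mu>' phi_diff A.grade_subset[OF grade[OF hs(1)]] by simp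
    also have "\<dots> = \<phi> (\<Oplus>\<^bsub>A\<^esub>j\<in>{1..<length hs}. ?t j)"
      using massey hs(1) by (simp add: trivial_massey_operation_def)
    also have "\<dots> = (\<Oplus>\<^bsub>B\<^esub>j\<in>{1..<length hs}. \<phi> (?t j))"
      using closed by (intro phi.abelian_group.hom_finsum) auto
    also have "\<dots> = (\<Oplus>\<^bsub>B\<^esub>j\<in>{1..<length gs}. bar B (\<mu>' (take j gs)) \<otimes>\<^bsub>B\<^esub> \<mu>' (drop j gs))"
      using image closed hs(2) by (intro B.M.finsum_cong'[symmetric]) auto
    finally show ?thesis .
  qed
  ultimately show ?thesis using basis by (simp add: trivial_massey_operation_def)
qed

end

theorem proposition2p11:
  fixes k :: "('k, 'p) ring_scheme"
    and R :: "('r, 'q) ring_scheme" and S :: "('s, 't) ring_scheme"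
    and A :: "('r, 'a, 'm) dg_algebra_scheme" and B :: "('s, 'b, 'n) dg_algebra_scheme"
    and \<epsilon>A :: "'k \<Rightarrow> 'a set" and \<epsilon>B :: "'k \<Rightarrow> 'b set"
    and \<phi> :: "'a \<Rightarrow> 'b" and \<B> :: "'a set set" and \<mu> :: "'a set list \<Rightarrow> 'a"
  assumes "field k"
    and "dg_algebra R A" and "dg_algebra S B"
    and "\<epsilon>A \<in> ring_iso k (homology0 A)" and "\<epsilon>B \<in> ring_iso k (homology0 B)"
    and "dg_morphism A B \<phi>" and "quasi_iso A B \<phi>"
    and "\<forall>c\<in>carrier k. \<forall>h\<in>carrier (homology_space \<epsilon>A A).
           homology_map A B \<phi> (c \<odot>\<^bsub>homology_space \<epsilon>A A\<^esub> h)
             = c \<odot>\<^bsub>homology_space \<epsilon>B B\<^esub> homology_map A B \<phi> h"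
    and "homogeneous_basis k \<epsilon>A A \<B>"
    and "trivial_massey_operation k \<epsilon>A A \<B> \<mu>"
  shows "(\<exists>!\<mu>'. \<mu>' \<in> words (homology_map A B \<phi> ` \<B>) \<rightarrow>\<^sub>E carrier B \<and>
            (\<forall>hs\<in>words \<B>. \<mu>' (map (homology_map A B \<phi>) hs) = \<phi> (\<mu> hs))) \<and>
         (\<forall>\<mu>'. (\<forall>hs\<in>words \<B>. \<mu>' (map (homology_map A B \<phi>) hs) = \<phi> (\<mu> hs)) \<longrightarrow>
            trivial_massey_operation k \<epsilon>B B (homology_map A B \<phi> ` \<B>) \<mu>')"
proof -
  interpret dg_quasi_iso R A S B \<phi>
    using assms(2,3,6,7)
    by (simp add: dg_quasi_iso_def dg_algebra_hom_def dg_algebra_hom_axioms_def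
        dg_quasi_iso_axioms_def)
  have "\<epsilon>A c \<in> homology_grade A 0" if "c \<in> carrier k" for c
    using assms(4) that by (auto simp: ring_iso_def ring_hom_def homology0_def)
  hence basis: "homogeneous_basis k \<epsilon>B B (\<phi>\<^sub>* ` \<B>)"
    using assms(8,9) by (intro homogeneous_basis_image) (auto simp: homology_space_def)
  have "\<B> \<subseteq> carrier (homology A)"
    using assms(9) A.homology_pos_closed by (auto simp: homogeneous_basis_def module_basis_def)
  hence "inj_on \<phi>\<^sub>* \<B>" using homology_map_inj inj_on_subset by blast
  hence "inj_on (map \<phi>\<^sub>*) (words \<B>)"
    by (intro inj_on_mapI) (auto simp: words_def inj_on_def)
  moreover have "\<phi> (\<mu> hs) \<in> carrier B" if "hs \<in> words \<B>" for hs
  proof -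
    have "\<mu> hs \<in> carrier A"
      using assms(10) that A.grade_subset by (auto simp: trivial_massey_operation_def)
    thus ?thesis by simp
  qed
  ultimately have "\<exists>!\<mu>'. \<mu>' \<in> words (\<phi>\<^sub>* ` \<B>) \<rightarrow>\<^sub>E carrier B \<and>
      (\<forall>hs\<in>words \<B>. \<mu>' (map \<phi>\<^sub>* hs) = \<phi> (\<mu> hs))"
    unfolding words_image by (rule unique_extensional_lift)
  thus ?thesis using trivial_massey_operation_image[OF basis assms(10)] by blast
qed

end
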